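(* Let $S$ be an intra-regular LA-semigroup with left identity and let $A$ be a nonempty subset of $S$. Then the following conditions are equivalent: (i) $A$ is an interior ideal of $S$; (ii) $(SA)S=A$.
   Context: An LA-semigroup (left almost semigroup) is a nonempty set $S$ with a binary operation, written as juxtaposition, satisfying the left invertive law $(ab)c=(cb)a$ for all $a,b,c\in S$ (associativity and commutativity are not assumed). A left identity is an element $e\in S$ with $ea=a$ for all $a\in S$. For subsets $A,B\subseteq S$, $AB=\{ab: a\in A,\ b\in B\}$. A nonempty subset $A\subseteq S$ is an interior ideal if $(SA)S\subseteq A$. $S$ is intra-regular if for every $a\in S$ there exist $x,y\in S$ such that $a=(xa^{2})y$, where $a^2=aa$. *)

theory Defs
  imports Main
begin

locale la_semigroup =
  fixes S :: "'a set" and mult :: "'a \<Rightarrow> 'a \<Rightarrow> 'a" (infixl "\<cdot>" 70)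
  assumes nonempty: "S \<noteq> {}"
    and closed: "\<lbrakk>a \<in> S; b \<in> S\<rbrakk> \<Longrightarrow> a \<cdot> b \<in> S"
    and left_invertive: "\<lbrakk>a \<in> S; b \<in> S; c \<in> S\<rbrakk> \<Longrightarrow> (a \<cdot> b) \<cdot> c = (c \<cdot> b) \<cdot> a"

definition left_identity :: "'a set \<Rightarrow> ('a \<Rightarrow> 'a \<Rightarrow> 'a) \<Rightarrow> 'a \<Rightarrow> bool" where
  "left_identity S mult e \<longleftrightarrow> e \<in> S \<and> (\<forall>a\<in>S. mult e a = a)"

definition set_prod :: "('a \<Rightarrow> 'a \<Rightarrow> 'a) \<Rightarrow> 'a set \<Rightarrow> 'a set \<Rightarrow> 'a set" where
  "set_prod mult A B = {mult a b | a b. a \<in> A \<and> b \<in> B}"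

definition interior_ideal :: "'a set \<Rightarrow> ('a \<Rightarrow> 'a \<Rightarrow> 'a) \<Rightarrow> 'a set \<Rightarrow> bool" where
  "interior_ideal S mult A \<longleftrightarrow>
     A \<noteq> {} \<and> A \<subseteq> S \<and> set_prod mult (set_prod mult S A) S \<subseteq> A"

definition intra_regular :: "'a set \<Rightarrow> ('a \<Rightarrow> 'a \<Rightarrow> 'a) \<Rightarrow> bool" where
  "intra_regular S mult \<longleftrightarrow>
     (\<forall>a\<in>S. \<exists>x\<in>S. \<exists>y\<in>S. a = mult (mult x (mult a a)) y)"

end

theory Submission
  imports Defs
begin

text \<open>
  An interior ideal contains \<open>(SA)S\<close> by definition, so the content is that intra-regularity
  forces \<open>A \<subseteq> (SA)S\<close>. A decomposition \<open>a = (xa\<^sup>2)y\<close> only shows that \<open>a\<close> lies in \<open>(SA\<^sup>2)S\<close>. In an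
  associative semigroup one would absorb one of the two factors \<open>a\<close> into its neighbour by
  rebracketing; here the law \<open>a(bc) = b(ac)\<close>, which holds in the presence of a left identity,
  together with left invertivity takes the place of associativity and turns the decomposition into
  \<open>a = (xa)((ye)a)\<close>.
\<close>

context la_semigroup
begin

text \<open>The outer two applications of left invertivity swap the two factors of the product, and the
  inner one, used in between, exchanges \<open>b\<close> with \<open>c\<close>.\<close>

lemma medial:
  assumes "a \<in> S" "b \<in> S" "c \<in> S" "d \<in> S"
  shows "(a \<cdot> b) \<cdot> (c \<cdot> d) = (a \<cdot> c) \<cdot> (b \<cdot> d)"
proof -
  have "(a \<cdot> b) \<cdot> (c \<cdot> d) = ((c \<cdot> d) \<cdot> b) \<cdot> a"
    using assms by (intro left_invertive closed)
  also have "\<dots> = ((b \<cdot> d) \<cdot> c) \<cdot> a"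
    using assms by (simp add: left_invertive[of c d b])
  also have "\<dots> = (a \<cdot> c) \<cdot> (b \<cdot> d)"
    using assms by (intro left_invertive closed)
  finally show ?thesis .
qed

text \<open>This is the medial law for \<open>(ea)(bc)\<close>.\<close>

lemma left_commute:
  assumes e: "left_identity S (\<cdot>) e" and "a \<in> S" "b \<in> S" "c \<in> S"
  shows "a \<cdot> (b \<cdot> c) = b \<cdot> (a \<cdot> c)"
  using medial[of e a b c] assms by (simp add: left_identity_def)

lemma intra_regular_decomposition:
  assumes e: "left_identity S (\<cdot>) e"
    and S: "a \<in> S" "x \<in> S" "y \<in> S"
    and a: "a = (x \<cdot> (a \<cdot> a)) \<cdot> y"
  shows "a = (x \<cdot> a) \<cdot> ((y \<cdot> e) \<cdot> a)"
proof -
  have eS: "e \<in> S" and ea: "e \<cdot> a = a"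
    using e S by (auto simp: left_identity_def)
  note mem = S eS
  have "x \<cdot> (a \<cdot> a) = a \<cdot> (x \<cdot> a)"
    using mem by (intro left_commute[OF e] closed)
  also have "\<dots> = (e \<cdot> a) \<cdot> (x \<cdot> a)"
    by (simp only: ea)
  also have "\<dots> = ((x \<cdot> a) \<cdot> a) \<cdot> e"
    using mem by (intro left_invertive closed)
  finally have "a = (((x \<cdot> a) \<cdot> a) \<cdot> e) \<cdot> y"
    using a by simp
  also have "\<dots> = (y \<cdot> e) \<cdot> ((x \<cdot> a) \<cdot> a)"
    using mem by (intro left_invertive closed)
  also have "\<dots> = (x \<cdot> a) \<cdot> ((y \<cdot> e) \<cdot> a)"
    using mem by (intro left_commute[OF e] closed)
  finally show ?thesis .
qed

lemma intra_regular_subset: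
  assumes e: "left_identity S (\<cdot>) e" and reg: "intra_regular S (\<cdot>)" and "A \<subseteq> S"
  shows "A \<subseteq> set_prod (\<cdot>) (set_prod (\<cdot>) S A) S"
proof
  fix a assume "a \<in> A"
  with \<open>A \<subseteq> S\<close> have "a \<in> S" by blast
  with reg obtain x y where xy: "x \<in> S" "y \<in> S" and "a = (x \<cdot> (a \<cdot> a)) \<cdot> y"
    unfolding intra_regular_def by blast
  with e \<open>a \<in> S\<close> have "a = (x \<cdot> a) \<cdot> ((y \<cdot> e) \<cdot> a)"
    by (intro intra_regular_decomposition)
  moreover have "(y \<cdot> e) \<cdot> a \<in> S"
    using e xy \<open>a \<in> S\<close> by (simp add: left_identity_def closed)
  ultimately show "a \<in> set_prod (\<cdot>) (set_prod (\<cdot>) S A) S"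
    using \<open>x \<in> S\<close> \<open>a \<in> A\<close> unfolding set_prod_def by blast
qed

end

theorem theorem10:
  fixes S A :: "'a set" and mult :: "'a \<Rightarrow> 'a \<Rightarrow> 'a"
  assumes "la_semigroup S mult"
    and "\<exists>e. left_identity S mult e"
    and "intra_regular S mult"
    and "A \<subseteq> S" and "A \<noteq> {}"
  shows "interior_ideal S mult A \<longleftrightarrow> set_prod mult (set_prod mult S A) S = A"
proof -
  from assms(2) obtain e where "left_identity S mult e" ..
  then have "A \<subseteq> set_prod mult (set_prod mult S A) S"
    using la_semigroup.intra_regular_subset[OF assms(1)] assms(3,4) by blast
  with assms(4,5) show ?thesis
    unfolding interior_ideal_def by blast
qed

end
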